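(* Assume the axiom of dependent choices. Let $A$ be a locale (frame), let $\eta_A:A\to\beta(A)$ be its Stone-Čech compactification, and let $B$ be a normal conjunctive sublattice of $A$ which is a base for $A$. Let $h:\beta(A)\to Id_{J_m^B}(B)$ be the unique locale map with $g=h\circ\eta_A$, where $g:A\to Id_{J_m^B}(B)$ is the locale map whose direct image sends $a\in A$ to the $J_m^B$-closure of the ideal $I_a=\{b\in B \mid b\le a\}$. Then $h$ is an isomorphism if and only if the direct image ${\eta_A}_\ast:A\to\beta(A)$ is injective on $B$ and its image $\eta_A(B):={\eta_A}_\ast(B)\subseteq\beta(A)$ is a $\beta(A)$-conjunctive base for $\beta(A)$. In particular, if $A$ is a completely regular locale and $B$ is a conjunctive normal base for it (for example, if $B$ is a normal $A$-conjunctive base for $A$), then $h$ is an isomorphism if and only if $\eta_A(B)\subseteq\beta(A)$ is a $\beta(A)$-conjunctive base for $\beta(A)$.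
   Context: All distributive lattices are bounded, and sublattices contain $0$ and $1$. A frame $A$ is regarded as a locale; a locale map $f:A\to A'$ is given by a frame homomorphism $f^\ast:A'\to A$, and its direct image is the right adjoint $f_\ast:A\to A'$ of $f^\ast$. A sublattice $B$ of a frame $A$ is a base for $A$ if every element of $A$ is a join of elements of $B$. A distributive lattice $D$ is normal if for all $a,b\in D$ with $a\vee b=1$ there are $c,d\in D$ with $c\vee a=b\vee d=1$ and $c\wedge d=0$. $D$ is conjunctive if for all $a,b\in D$: if every $c\in D$ with $a\vee c=1$ satisfies $b\vee c=1$, then $a\le b$. A sublattice $B$ of a frame $A$ is $A$-conjunctive if for all $a\in A$ and $b\in B$: if for every $c\in B$ with $c\vee b=1$ there is $d\in B$ with $d\le a$ and $c\vee d=1$, then $b\le a$. (In particular, saying that $\eta_A(B)$ is a $\beta(A)$-conjunctive base includes that $\eta_A(B)$ is a sublattice of $\beta(A)$ and a base for it.) For a distributive lattice $D$, the maximal topology $J_m^D$ on $D$ is the Grothendieck topology in which a sieve $\{c_i\le c\mid i\in I\}$ on $c$ is covering iff for every $d\in D$ with $c\vee d=1$ there is a finite $J\subseteq I$ with $\bigvee_{i\in J}c_i\vee d=1$. The $J_m^D$-closure of an ideal $I$ of $D$ is $\{x\in D\mid \forall b\in D\,(x\vee b=1\Rightarrow \exists y\in I,\ y\vee b=1)\}$, and $Id_{J_m^D}(D)$ is the frame of $J_m^D$-closed ideals of $D$, ordered by inclusion. If $B$ is normal, $Id_{J_m^B}(B)$ is a compact regular locale and the function $a\mapsto (J_m^B\text{-closure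 of } I_a)$ is the direct image of a locale map $g$. The Stone-Čech compactification $\eta_A:A\to\beta(A)$ is the universal locale map from $A$ to a compact regular locale; this universal property gives $h$. *)

theory Defs
  imports Complex_Main "HOL-Algebra.Galois_Connection"
begin

section \<open>Frames and locale maps\<close>

locale frame = complete_lattice L for L (structure) +
  assumes meet_Sup_distrib:
    "\<lbrakk>a \<in> carrier L; S \<subseteq> carrier L\<rbrakk> \<Longrightarrow> a \<sqinter> \<Squnion>S = \<Squnion>((\<lambda>s. a \<sqinter> s) ` S)"

text \<open>Homomorphisms are extensional functions, so that equality of homomorphisms (and hence
  unique existence) is plain equality in HOL.\<close>

definition frame_hom :: "'a gorder \<Rightarrow> 'b gorder \<Rightarrow> ('a \<Rightarrow> 'b) \<Rightarrow> bool" where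
  "frame_hom L M f \<longleftrightarrow>
     f \<in> carrier L \<rightarrow>\<^sub>E carrier M \<and> sup_pres L M f \<and> meet_pres L M f \<and> f \<top>\<^bsub>L\<^esub> = \<top>\<^bsub>M\<^esub>"

text \<open>A locale map from \<open>A\<close> to \<open>A'\<close> is represented by its inverse image, a frame homomorphism
  from \<open>A'\<close> to \<open>A\<close>.  In \<open>locale_comp N k f\<close>, which stands for \<open>k\<close> after \<open>f\<close>, the frame \<open>N\<close>
  is the codomain of \<open>k\<close> as a locale map.\<close>

definition locale_map :: "'a gorder \<Rightarrow> 'b gorder \<Rightarrow> ('b \<Rightarrow> 'a) \<Rightarrow> bool" where
  "locale_map A A' f \<longleftrightarrow> frame A \<and> frame A' \<and> frame_hom A' A f"

definition locale_comp :: "'c gorder \<Rightarrow> ('c \<Rightarrow> 'b) \<Rightarrow> ('b \<Rightarrow> 'a) \<Rightarrow> 'c \<Rightarrow> 'a" where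
  "locale_comp N k f = compose (carrier N) f k"

definition locale_id :: "'a gorder \<Rightarrow> 'a \<Rightarrow> 'a" where
  "locale_id L = (\<lambda>x\<in>carrier L. x)"

definition locale_iso :: "'a gorder \<Rightarrow> 'b gorder \<Rightarrow> ('b \<Rightarrow> 'a) \<Rightarrow> bool" where
  "locale_iso L M h \<longleftrightarrow> locale_map L M h \<and>
     (\<exists>k. locale_map M L k \<and> locale_comp L k h = locale_id L \<and> locale_comp M h k = locale_id M)"

definition direct_image :: "'a gorder \<Rightarrow> 'b gorder \<Rightarrow> ('b \<Rightarrow> 'a) \<Rightarrow> 'a \<Rightarrow> 'b" where
  "direct_image A A' f a = \<Squnion>\<^bsub>A'\<^esub>{x \<in> carrier A'. f x \<sqsubseteq>\<^bsub>A\<^esub> a}"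

lemma direct_image_right_adjoint:
  assumes "locale_map A A' f"
  shows "galois_connection \<lparr>orderA = A', orderB = A, lower = f, upper = direct_image A A' f\<rparr>"
proof -
  interpret A: frame A using assms by (simp add: locale_map_def)
  interpret A': frame A' using assms by (simp add: locale_map_def)
  have hom: "frame_hom A' A f" using assms by (simp add: locale_map_def)
  have f: "f \<in> carrier A' \<rightarrow> carrier A"
    using hom by (auto simp: frame_hom_def)
  have iso: "f x \<sqsubseteq>\<^bsub>A\<^esub> f y"
    if "x \<in> carrier A'" "y \<in> carrier A'" "x \<sqsubseteq>\<^bsub>A'\<^esub> y" for x y
    using meet_pres_isotone[OF f] hom that by (auto simp: frame_hom_def isotone_def)
  have closed: "direct_image A A' f a \<in> carrier A'" for a
    by (auto simp: direct_image_def intro!: A'.sup_closed)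
  have counit: "f (direct_image A A' f a) \<sqsubseteq>\<^bsub>A\<^esub> a" if "a \<in> carrier A" for a
  proof -
    let ?S = "{x \<in> carrier A'. f x \<sqsubseteq>\<^bsub>A\<^esub> a}"
    have "f (\<Squnion>\<^bsub>A'\<^esub>?S) = \<Squnion>\<^bsub>A\<^esub>(f ` ?S)"
      using hom by (simp add: frame_hom_def sup_pres_def)
    moreover have "\<Squnion>\<^bsub>A\<^esub>(f ` ?S) \<sqsubseteq>\<^bsub>A\<^esub> a"
      using f that by (intro A.sup_least) auto
    ultimately show ?thesis by (simp add: direct_image_def)
  qed
  have "f x \<sqsubseteq>\<^bsub>A\<^esub> a \<longleftrightarrow> x \<sqsubseteq>\<^bsub>A'\<^esub> direct_image A A' f a"
    if x: "x \<in> carrier A'" and a: "a \<in> carrier A" for x a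
  proof
    assume "f x \<sqsubseteq>\<^bsub>A\<^esub> a"
    then show "x \<sqsubseteq>\<^bsub>A'\<^esub> direct_image A A' f a"
      unfolding direct_image_def using x by (intro A'.sup_upper) auto
  next
    assume "x \<sqsubseteq>\<^bsub>A'\<^esub> direct_image A A' f a"
    then have "f x \<sqsubseteq>\<^bsub>A\<^esub> f (direct_image A A' f a)"
      using iso[OF x closed] by metis
    then show "f x \<sqsubseteq>\<^bsub>A\<^esub> a"
      using A.le_trans[OF _ counit[OF a]] funcset_mem[OF f x] funcset_mem[OF f closed] a by metis
  qed
  then show ?thesis
    using f closed A.partial_order_axioms A'.partial_order_axioms
    by (simp add: galois_connection_def galois_connection_axioms_def connection_def)
qed


section \<open>Compactness and regularity\<close>

definition compact_frame :: "'a gorder \<Rightarrow> bool" where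
  "compact_frame L \<longleftrightarrow> frame L \<and>
     (\<forall>S\<subseteq>carrier L. \<Squnion>\<^bsub>L\<^esub>S = \<top>\<^bsub>L\<^esub> \<longrightarrow> (\<exists>F\<subseteq>S. finite F \<and> \<Squnion>\<^bsub>L\<^esub>F = \<top>\<^bsub>L\<^esub>))"

definition well_inside :: "'a gorder \<Rightarrow> 'a \<Rightarrow> 'a \<Rightarrow> bool" where
  "well_inside L x y \<longleftrightarrow> x \<in> carrier L \<and> y \<in> carrier L \<and>
     (\<exists>z\<in>carrier L. x \<sqinter>\<^bsub>L\<^esub> z = \<bottom>\<^bsub>L\<^esub> \<and> y \<squnion>\<^bsub>L\<^esub> z = \<top>\<^bsub>L\<^esub>)"

definition regular_frame :: "'a gorder \<Rightarrow> bool" where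
  "regular_frame L \<longleftrightarrow> frame L \<and> (\<forall>a\<in>carrier L. a = \<Squnion>\<^bsub>L\<^esub>{x. well_inside L x a})"

definition really_inside :: "'a gorder \<Rightarrow> 'a \<Rightarrow> 'a \<Rightarrow> bool" where
  "really_inside L x y \<longleftrightarrow>
     (\<exists>s :: rat \<Rightarrow> 'a. s 0 = x \<and> s 1 = y \<and>
        (\<forall>p q. 0 \<le> p \<and> p < q \<and> q \<le> 1 \<longrightarrow> well_inside L (s p) (s q)))"

definition completely_regular_frame :: "'a gorder \<Rightarrow> bool" where
  "completely_regular_frame L \<longleftrightarrow>
     frame L \<and> (\<forall>a\<in>carrier L. a = \<Squnion>\<^bsub>L\<^esub>{x. really_inside L x a})"

definition compact_regular :: "'a gorder \<Rightarrow> bool" where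
  "compact_regular L \<longleftrightarrow> compact_frame L \<and> regular_frame L"


section \<open>The Stone-Cech compactification\<close>

definition factors_uniquely :: "'a gorder \<Rightarrow> 'b gorder \<Rightarrow> ('b \<Rightarrow> 'a) \<Rightarrow> 'c gorder \<Rightarrow> bool" where
  "factors_uniquely A bA eta L \<longleftrightarrow>
     (\<forall>f. locale_map A L f \<longrightarrow> (\<exists>!h. locale_map bA L h \<and> f = locale_comp L h eta))"

text \<open>A formula cannot quantify over types, so the universal property is required for compact
  regular frames carried by the type \<open>'a set\<close> and by the type \<open>'b\<close> of \<open>bA\<close>.  This already
  determines \<open>bA\<close> up to isomorphism over \<open>A\<close>: the frame of completely regular ideals of \<open>A\<close>,
  which has the universal property for all frames, is carried by \<open>'a set\<close>, and comparing it with
  \<open>bA\<close> uses only these two types.\<close>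

definition stone_cech :: "'a gorder \<Rightarrow> 'b gorder \<Rightarrow> ('b \<Rightarrow> 'a) \<Rightarrow> bool" where
  "stone_cech A bA eta \<longleftrightarrow> compact_regular bA \<and> locale_map A bA eta \<and>
     (\<forall>L :: 'a set gorder. compact_regular L \<longrightarrow> factors_uniquely A bA eta L) \<and>
     (\<forall>L :: 'b gorder. compact_regular L \<longrightarrow> factors_uniquely A bA eta L)"


section \<open>Sublattices, bases, normality and conjunctivity\<close>

definition sublattice :: "'a gorder \<Rightarrow> 'a set \<Rightarrow> bool" where
  "sublattice A B \<longleftrightarrow> B \<subseteq> carrier A \<and> \<bottom>\<^bsub>A\<^esub> \<in> B \<and> \<top>\<^bsub>A\<^esub> \<in> B \<and>
     (\<forall>x\<in>B. \<forall>y\<in>B. x \<squnion>\<^bsub>A\<^esub> y \<in> B \<and> x \<sqinter>\<^bsub>A\<^esub> y \<in> B)"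

abbreviation sub :: "'a gorder \<Rightarrow> 'a set \<Rightarrow> 'a gorder" where
  "sub A B \<equiv> A\<lparr>carrier := B\<rparr>"

definition base :: "'a gorder \<Rightarrow> 'a set \<Rightarrow> bool" where
  "base A B \<longleftrightarrow> sublattice A B \<and> (\<forall>a\<in>carrier A. \<exists>S\<subseteq>B. a = \<Squnion>\<^bsub>A\<^esub>S)"

text \<open>In the following definitions \<open>D\<close> is a bounded distributive lattice; they are applied to
  \<open>sub A B\<close> for a sublattice \<open>B\<close> of a frame \<open>A\<close>, whose operations are those of \<open>A\<close> by the next
  lemma.\<close>

lemma sublattice_operations:
  assumes "frame A" and B: "sublattice A B"
  shows "\<bottom>\<^bsub>sub A B\<^esub> = \<bottom>\<^bsub>A\<^esub>" and "\<top>\<^bsub>sub A B\<^esub> = \<top>\<^bsub>A\<^esub>"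
    and "\<lbrakk>x \<in> B; y \<in> B\<rbrakk> \<Longrightarrow> x \<squnion>\<^bsub>sub A B\<^esub> y = x \<squnion>\<^bsub>A\<^esub> y"
    and "\<lbrakk>x \<in> B; y \<in> B\<rbrakk> \<Longrightarrow> x \<sqinter>\<^bsub>sub A B\<^esub> y = x \<sqinter>\<^bsub>A\<^esub> y"
proof -
  interpret A: frame A by fact
  have sub: "B \<subseteq> carrier A" using B by (simp add: sublattice_def)
  interpret S: weak_partial_order "sub A B"
    using weak_partial_order_subset[OF _ sub] A.weak_partial_order_axioms by simp
  interpret S: partial_order "sub A B"
    by unfold_locales (simp add: A.eq_is_equal)
  show "\<bottom>\<^bsub>sub A B\<^esub> = \<bottom>\<^bsub>A\<^esub>"
  proof -
    have *: "least (sub A B) \<bottom>\<^bsub>A\<^esub> (carrier (sub A B))"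
      using B sub by (auto simp: least_def sublattice_def)
    show ?thesis
      unfolding bottom_def[of "sub A B"]
      by (rule some_equality, rule *, rule S.least_unique[OF _ *])
  qed
  show "\<top>\<^bsub>sub A B\<^esub> = \<top>\<^bsub>A\<^esub>"
  proof -
    have *: "greatest (sub A B) \<top>\<^bsub>A\<^esub> (carrier (sub A B))"
      using B sub by (auto simp: greatest_def sublattice_def)
    show ?thesis
      unfolding top_def[of "sub A B"]
      by (rule some_equality, rule *, rule S.greatest_unique[OF _ *])
  qed
  show "x \<squnion>\<^bsub>sub A B\<^esub> y = x \<squnion>\<^bsub>A\<^esub> y" if xy: "x \<in> B" "y \<in> B"
  proof -
    have c: "x \<in> carrier A" "y \<in> carrier A" "x \<squnion>\<^bsub>A\<^esub> y \<in> B"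
      using xy sub B by (auto simp: sublattice_def)
    have *: "least (sub A B) (x \<squnion>\<^bsub>A\<^esub> y) (Upper (sub A B) {x, y})"
    proof (rule least_UpperI)
      show "x \<squnion>\<^bsub>A\<^esub> y \<sqsubseteq>\<^bsub>sub A B\<^esub> z" if "z \<in> Upper (sub A B) {x, y}" for z
        using that c xy sub by (auto simp: Upper_def intro!: A.join_le)
    qed (use c xy A.join_left[of x y] A.join_right[of x y] in auto)
    show ?thesis
      unfolding join_def[of "sub A B"] sup_def[of "sub A B"]
      by (rule some_equality, rule *, rule S.least_unique[OF _ *])
  qed
  show "x \<sqinter>\<^bsub>sub A B\<^esub> y = x \<sqinter>\<^bsub>A\<^esub> y" if xy: "x \<in> B" "y \<in> B"
  proof -
    have c: "x \<in> carrier A" "y \<in> carrier A" "x \<sqinter>\<^bsub>A\<^esub> y \<in> B"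
      using xy sub B by (auto simp: sublattice_def)
    have *: "greatest (sub A B) (x \<sqinter>\<^bsub>A\<^esub> y) (Lower (sub A B) {x, y})"
    proof (rule greatest_LowerI)
      show "z \<sqsubseteq>\<^bsub>sub A B\<^esub> x \<sqinter>\<^bsub>A\<^esub> y" if "z \<in> Lower (sub A B) {x, y}" for z
        using that c xy sub by (auto simp: Lower_def intro!: A.meet_le)
    qed (use c xy A.meet_left[of x y] A.meet_right[of x y] in auto)
    show ?thesis
      unfolding meet_def[of "sub A B"] inf_def[of "sub A B"]
      by (rule some_equality, rule *, rule S.greatest_unique[OF _ *])
  qed
qed

definition normal_lattice :: "'a gorder \<Rightarrow> bool" where
  "normal_lattice D \<longleftrightarrow>
     (\<forall>a\<in>carrier D. \<forall>b\<in>carrier D. a \<squnion>\<^bsub>D\<^esub> b = \<top>\<^bsub>D\<^esub> \<longrightarrow>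
        (\<exists>c\<in>carrier D. \<exists>d\<in>carrier D.
           c \<squnion>\<^bsub>D\<^esub> a = \<top>\<^bsub>D\<^esub> \<and> b \<squnion>\<^bsub>D\<^esub> d = \<top>\<^bsub>D\<^esub> \<and> c \<sqinter>\<^bsub>D\<^esub> d = \<bottom>\<^bsub>D\<^esub>))"

definition conjunctive_lattice :: "'a gorder \<Rightarrow> bool" where
  "conjunctive_lattice D \<longleftrightarrow>
     (\<forall>a\<in>carrier D. \<forall>b\<in>carrier D.
        (\<forall>c\<in>carrier D. a \<squnion>\<^bsub>D\<^esub> c = \<top>\<^bsub>D\<^esub> \<longrightarrow> b \<squnion>\<^bsub>D\<^esub> c = \<top>\<^bsub>D\<^esub>) \<longrightarrow> a \<sqsubseteq>\<^bsub>D\<^esub> b)"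

definition frame_conjunctive :: "'a gorder \<Rightarrow> 'a set \<Rightarrow> bool" where
  "frame_conjunctive A B \<longleftrightarrow> sublattice A B \<and>
     (\<forall>a\<in>carrier A. \<forall>b\<in>B.
        (\<forall>c\<in>B. c \<squnion>\<^bsub>A\<^esub> b = \<top>\<^bsub>A\<^esub> \<longrightarrow> (\<exists>d\<in>B. d \<sqsubseteq>\<^bsub>A\<^esub> a \<and> c \<squnion>\<^bsub>A\<^esub> d = \<top>\<^bsub>A\<^esub>)) \<longrightarrow>
        b \<sqsubseteq>\<^bsub>A\<^esub> a)"


section \<open>Closed ideals for the maximal topology\<close>

definition lattice_ideal :: "'a gorder \<Rightarrow> 'a set \<Rightarrow> bool" where
  "lattice_ideal D I \<longleftrightarrow> I \<subseteq> carrier D \<and> \<bottom>\<^bsub>D\<^esub> \<in> I \<and>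
     (\<forall>x\<in>I. \<forall>y\<in>I. x \<squnion>\<^bsub>D\<^esub> y \<in> I) \<and> (\<forall>x\<in>I. \<forall>y\<in>carrier D. y \<sqsubseteq>\<^bsub>D\<^esub> x \<longrightarrow> y \<in> I)"

text \<open>The maximal topology lets a sieve \<open>S\<close> on \<open>c\<close> cover iff every \<open>d\<close> with
  \<open>c \<squnion> d = \<top>\<close> satisfies \<open>\<Squnion>F \<squnion> d = \<top>\<close> for some finite \<open>F \<subseteq> S\<close>.  For an ideal \<open>I\<close>, the
  sieve of those elements of \<open>I\<close> that lie below \<open>x\<close> covers \<open>x\<close> exactly under the condition
  below, since \<open>I\<close> is closed under finite joins and \<open>D\<close> is distributive.\<close>

definition Jm_closure :: "'a gorder \<Rightarrow> 'a set \<Rightarrow> 'a set" where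
  "Jm_closure D I =
     {x \<in> carrier D. \<forall>b\<in>carrier D. x \<squnion>\<^bsub>D\<^esub> b = \<top>\<^bsub>D\<^esub> \<longrightarrow> (\<exists>y\<in>I. y \<squnion>\<^bsub>D\<^esub> b = \<top>\<^bsub>D\<^esub>)}"

definition Id_Jm :: "'a gorder \<Rightarrow> 'a set gorder" where
  "Id_Jm D = \<lparr>carrier = {I. lattice_ideal D I \<and> Jm_closure D I = I}, eq = (=), le = (\<subseteq>)\<rparr>"

end

theory Submission
  imports Defs "HOL-Library.Countable"
begin

text \<open>
  Write \<open>E\<close> for the direct image of \<open>eta\<close>.  Since \<open>B\<close> is conjunctive, the direct image of \<open>g\<close>
  sends \<open>b \<in> B\<close> to the principal ideal \<open>\<down>b\<close>; it factors through \<open>E\<close>, so \<open>E\<close> reflects the order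
  of \<open>B\<close> and injectivity of \<open>E\<close> on \<open>B\<close> is automatic.  If \<open>h\<close> is an isomorphism, it identifies
  \<open>E b\<close> with \<open>\<down>b\<close>, and the principal ideals form a conjunctive base of the frame of closed ideals.
  Conversely, \<open>\<psi> u = {b. E b \<sqsubseteq> u}\<close> and \<open>I \<mapsto> \<Squnion>(E ` I)\<close> are mutually inverse, by conjunctivity
  and compactness of \<open>bA\<close>; the inequality \<open>h (\<psi> u) \<sqsubseteq> u\<close> is immediate, and two comparable frame
  homomorphisms on a regular frame agree, so \<open>h\<close> is inverse to \<open>\<psi>\<close>.

  Normality makes the relation of being well inside, with complement in \<open>B\<close>, interpolative, and
  dependent choice turns it into a rational scale; conjunctivity of \<open>B\<close> in \<open>A\<close>, applied to the join
  of the elements really inside \<open>a\<close>, then yields complete regularity.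
\<close>

section \<open>Frames\<close>

context frame
begin

lemma join_eq_Sup: "x \<squnion> y = \<Squnion>{x, y}"
  by (simp add: join_def)

lemma Sup_mono:
  assumes "S \<subseteq> T" "T \<subseteq> carrier L"
  shows "\<Squnion>S \<sqsubseteq> \<Squnion>T"
  using assms by (intro sup_least) (auto intro!: sup_upper)

lemma meet_join_distrib:
  assumes "x \<in> carrier L" "y \<in> carrier L" "z \<in> carrier L"
  shows "x \<sqinter> (y \<squnion> z) = (x \<sqinter> y) \<squnion> (x \<sqinter> z)"
  using meet_Sup_distrib[of x "{y, z}"] assms by (simp add: join_eq_Sup)

lemma top_le_iff: "x \<in> carrier L \<Longrightarrow> \<top> \<sqsubseteq> x \<longleftrightarrow> x = \<top>"
  by (auto intro: le_antisym)

lemma join_mono: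
  assumes "x \<sqsubseteq> x'" "y \<sqsubseteq> y'"
    and "x \<in> carrier L" "x' \<in> carrier L" "y \<in> carrier L" "y' \<in> carrier L"
  shows "x \<squnion> y \<sqsubseteq> x' \<squnion> y'"
proof (rule join_le)
  show "x \<sqsubseteq> x' \<squnion> y'" by (rule le_trans[OF assms(1) join_left]) (use assms in auto)
  show "y \<sqsubseteq> x' \<squnion> y'" by (rule le_trans[OF assms(2) join_right]) (use assms in auto)
qed (use assms in auto)

lemma join_top_mono:
  assumes "x \<squnion> y = \<top>" "x \<sqsubseteq> x'" "y \<sqsubseteq> y'"
    and "x \<in> carrier L" "x' \<in> carrier L" "y \<in> carrier L" "y' \<in> carrier L"
  shows "x' \<squnion> y' = \<top>"
  using join_mono[OF assms(2-7)] assms by (simp add: top_le_iff)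

text \<open>Distributing \<open>x\<close> over \<open>y \<squnion> z = \<top>\<close> leaves only
  \<open>x \<sqinter> y\<close>. This is why well inside implies below, and it is also how
  regularity is exploited later.\<close>

lemma le_if_meet_bottom_join_top:
  assumes "x \<in> carrier L" "y \<in> carrier L" "z \<in> carrier L"
    and "x \<sqinter> z = \<bottom>" "y \<squnion> z = \<top>"
  shows "x \<sqsubseteq> y"
proof -
  have "x = x \<sqinter> (y \<squnion> z)"
    unfolding assms(5) by (rule le_antisym) (use assms in \<open>auto intro: meet_le meet_left\<close>)
  also have "\<dots> = (x \<sqinter> y) \<squnion> \<bottom>"
    using meet_join_distrib[of x y z] assms(1-4) by simp
  also have "\<dots> \<sqsubseteq> y"
    using assms by (intro join_le) (simp_all add: meet_right)
  finally show ?thesis .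
qed

lemma meet_bottom_mono:
  assumes "x \<sqsubseteq> y" "y \<sqinter> z = \<bottom>" "x \<in> carrier L" "y \<in> carrier L" "z \<in> carrier L"
  shows "x \<sqinter> z = \<bottom>"
proof (rule le_antisym)
  have "x \<sqinter> z \<sqsubseteq> y \<sqinter> z"
  proof (rule meet_le)
    show "x \<sqinter> z \<sqsubseteq> y" by (rule le_trans[OF meet_left assms(1)]) (use assms in auto)
  qed (use assms meet_right in auto)
  then show "x \<sqinter> z \<sqsubseteq> \<bottom>" using assms by simp
qed (use assms in auto)

end

section \<open>The relations well inside and really inside\<close>

context
  fixes L :: "'a gorder" (structure)
  assumes L: "frame L"
begin

interpretation frame L by (rule L)

lemma well_inside_le: "well_inside L x y \<Longrightarrow> x \<sqsubseteq> y"
  unfolding well_inside_def by (blast intro: le_if_meet_bottom_join_top)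

lemma well_inside_mono_right:
  assumes "well_inside L x y" "y \<sqsubseteq> z" "z \<in> carrier L"
  shows "well_inside L x z"
proof -
  obtain w where "w \<in> carrier L" "x \<sqinter> w = \<bottom>" "y \<squnion> w = \<top>" "x \<in> carrier L" "y \<in> carrier L"
    using assms unfolding well_inside_def by blast
  then show ?thesis
    unfolding well_inside_def using join_top_mono[of y w z w] assms by auto
qed

lemma really_inside_le: "really_inside L x y \<Longrightarrow> well_inside L x y"
  unfolding really_inside_def by (metis order_refl zero_less_one)

lemma really_inside_mono_right:
  assumes "really_inside L x y" "y \<sqsubseteq> z" "z \<in> carrier L"
  shows "really_inside L x z"
proof -
  obtain s :: "rat \<Rightarrow> 'a" where s: "s 0 = x" "s 1 = y"
    "\<And>p q. \<lbrakk>0 \<le> p; p < q; q \<le> 1\<rbrakk> \<Longrightarrow> well_inside L (s p) (s q)"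
    using assms(1) unfolding really_inside_def by blast
  \<comment> \<open>Since \<open>p < q\<close> and \<open>q \<le> 1\<close>, the altered index
    \<open>1\<close> can only occur as the larger one, so monotonicity on the right is
    enough.\<close>
  have "well_inside L ((s(1 := z)) p) ((s(1 := z)) q)" if "0 \<le> p" "p < q" "q \<le> 1" for p q
    using s(3)[OF that] s(2) that well_inside_mono_right[OF _ assms(2,3)] by auto
  then show ?thesis
    unfolding really_inside_def using s(1) by (intro exI[of _ "s(1 := z)"]) auto
qed

end

section \<open>Frame homomorphisms\<close>

lemma frame_hom_join:
  assumes "frame_hom L M f" "x \<in> carrier L" "y \<in> carrier L"
  shows "f (x \<squnion>\<^bsub>L\<^esub> y) = f x \<squnion>\<^bsub>M\<^esub> f y"
proof -
  have "join_pres L M f"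
    using assms sup_pres_is_join_pres weak_sup_pres unfolding frame_hom_def by blast
  then show ?thesis
    using assms unfolding join_pres_def by blast
qed

lemma frame_hom_meet:
  assumes "frame_hom L M f" "x \<in> carrier L" "y \<in> carrier L"
  shows "f (x \<sqinter>\<^bsub>L\<^esub> y) = f x \<sqinter>\<^bsub>M\<^esub> f y"
  using assms unfolding frame_hom_def meet_pres_def by blast

lemma frame_hom_Sup:
  assumes "frame_hom L M f" "S \<subseteq> carrier L"
  shows "f (\<Squnion>\<^bsub>L\<^esub>S) = \<Squnion>\<^bsub>M\<^esub>(f ` S)"
  using assms unfolding frame_hom_def sup_pres_def by blast

lemma frame_hom_top: "frame_hom L M f \<Longrightarrow> f \<top>\<^bsub>L\<^esub> = \<top>\<^bsub>M\<^esub>"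
  by (simp add: frame_hom_def)

lemma frame_hom_closed: "frame_hom L M f \<Longrightarrow> x \<in> carrier L \<Longrightarrow> f x \<in> carrier M"
  by (auto simp: frame_hom_def)

lemma frame_hom_mono:
  assumes "frame_hom L M f" "x \<in> carrier L" "y \<in> carrier L" "x \<sqsubseteq>\<^bsub>L\<^esub> y"
  shows "f x \<sqsubseteq>\<^bsub>M\<^esub> f y"
  using meet_pres_isotone[of f L M] assms by (auto simp: frame_hom_def isotone_def)

text \<open>The bottom is the join of the empty set, so \<open>sup_pres\<close> takes care of
  it.\<close>

lemma frame_hom_bottom:
  assumes "frame_hom L M f"
  shows "f \<bottom>\<^bsub>L\<^esub> = \<bottom>\<^bsub>M\<^esub>"
proof -
  interpret L: complete_lattice L
    using assms by (simp add: frame_hom_def sup_pres_def)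
  interpret M: complete_lattice M
    using assms by (simp add: frame_hom_def sup_pres_def)
  show ?thesis
    using frame_hom_Sup[OF assms, of "{}"] L.weak_sup_empty M.weak_sup_empty
    by (simp add: L.eq_is_equal M.eq_is_equal)
qed

section \<open>Direct images and isomorphisms of locales\<close>

lemma direct_image_adjoint:
  assumes "locale_map A A' f" "x \<in> carrier A'" "a \<in> carrier A"
  shows "f x \<sqsubseteq>\<^bsub>A\<^esub> a \<longleftrightarrow> x \<sqsubseteq>\<^bsub>A'\<^esub> direct_image A A' f a"
proof -
  interpret galois_connection "\<lparr>orderA = A', orderB = A, lower = f, upper = direct_image A A' f\<rparr>"
    by (rule direct_image_right_adjoint) fact
  show ?thesis
    using left[of x a] right[of x a] assms by auto
qed

lemma direct_image_closed:
  assumes "locale_map A A' f"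
  shows "direct_image A A' f a \<in> carrier A'"
proof -
  interpret frame A' using assms by (simp add: locale_map_def)
  show ?thesis by (auto simp: direct_image_def intro!: sup_closed)
qed

lemma direct_image_mono:
  assumes f: "locale_map A A' f" and ab: "a \<in> carrier A" "b \<in> carrier A" "a \<sqsubseteq>\<^bsub>A\<^esub> b"
  shows "direct_image A A' f a \<sqsubseteq>\<^bsub>A'\<^esub> direct_image A A' f b"
proof -
  interpret galois_connection "\<lparr>orderA = A', orderB = A, lower = f, upper = direct_image A A' f\<rparr>"
    by (rule direct_image_right_adjoint) fact
  show ?thesis
    using upper_iso ab by (auto simp: isotone_def)
qed

text \<open>The set-theoretic inverse of a bijective frame homomorphism is again a frame
  homomorphism: each required equation is checked after applying \<open>h\<close>.\<close>

lemma locale_iso_iff_bij: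
  assumes h: "locale_map L M h"
  shows "locale_iso L M h \<longleftrightarrow> bij_betw h (carrier M) (carrier L)"
proof
  assume "locale_iso L M h"
  then obtain k where k: "locale_map M L k" "locale_comp L k h = locale_id L"
      "locale_comp M h k = locale_id M"
    unfolding locale_iso_def by blast
  have "h (k u) = u" if "u \<in> carrier L" for u
    using fun_cong[OF k(2), of u] that by (simp add: locale_comp_def locale_id_def compose_def)
  moreover have "k (h u) = u" if "u \<in> carrier M" for u
    using fun_cong[OF k(3), of u] that by (simp add: locale_comp_def locale_id_def compose_def)
  moreover have "h \<in> carrier M \<rightarrow> carrier L" "k \<in> carrier L \<rightarrow> carrier M"
    using h k(1) by (auto simp: locale_map_def frame_hom_def)
  ultimately show "bij_betw h (carrier M) (carrier L)"
    by (intro bij_betwI[of h _ _ k])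
next
  assume bij: "bij_betw h (carrier M) (carrier L)"
  interpret L: frame L using h by (simp add: locale_map_def)
  interpret M: frame M using h by (simp add: locale_map_def)
  have hom: "frame_hom M L h" using h by (simp add: locale_map_def)
  \<comment> \<open>The restriction to the carrier makes \<open>k\<close> extensional, as
    \<open>frame_hom\<close> demands.\<close>
  define k where "k = (\<lambda>u\<in>carrier L. inv_into (carrier M) h u)"
  have hk: "h (k u) = u" if "u \<in> carrier L" for u
    using that bij by (simp add: k_def bij_betw_inv_into_right)
  have kh: "k (h x) = x" if "x \<in> carrier M" for x
    using that bij frame_hom_closed[OF hom] by (simp add: k_def bij_betw_inv_into_left)
  have kc: "k u \<in> carrier M" if "u \<in> carrier L" for u
    using that bij by (simp add: k_def bij_betw_def inv_into_into)
  have "frame_hom L M k"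
    unfolding frame_hom_def
  proof (intro conjI)
    show "k \<in> carrier L \<rightarrow>\<^sub>E carrier M"
      using kc by (auto simp: k_def)
    show "sup_pres L M k"
      unfolding sup_pres_def
    proof (intro conjI allI impI L.complete_lattice_axioms M.complete_lattice_axioms)
      fix S assume S: "S \<subseteq> carrier L"
      then have kS: "k ` S \<subseteq> carrier M" using kc by auto
      have "h ` k ` S = (\<lambda>u. u) ` S"
        unfolding image_image using S hk by (intro image_cong) auto
      then have "h (\<Squnion>\<^bsub>M\<^esub>(k ` S)) = \<Squnion>\<^bsub>L\<^esub>S"
        using frame_hom_Sup[OF hom kS] by simp
      then show "k (\<Squnion>\<^bsub>L\<^esub>S) = \<Squnion>\<^bsub>M\<^esub>(k ` S)"
        using kh[OF M.sup_closed[OF kS]] by simp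
    qed
    show "meet_pres L M k"
      unfolding meet_pres_def
    proof (intro conjI ballI L.lattice_axioms M.lattice_axioms)
      fix x y assume xy: "x \<in> carrier L" "y \<in> carrier L"
      then have "h (k x \<sqinter>\<^bsub>M\<^esub> k y) = x \<sqinter>\<^bsub>L\<^esub> y"
        using frame_hom_meet[OF hom] kc hk by simp
      then show "k (x \<sqinter>\<^bsub>L\<^esub> y) = k x \<sqinter>\<^bsub>M\<^esub> k y"
        using kh[OF M.meet_closed[OF kc[OF xy(1)] kc[OF xy(2)]]] by simp
    qed
    show "k \<top>\<^bsub>L\<^esub> = \<top>\<^bsub>M\<^esub>"
      using kh[OF M.top_closed] frame_hom_top[OF hom] by simp
  qed
  then have "locale_map M L k"
    using h by (simp add: locale_map_def)
  moreover have "locale_comp L k h = locale_id L"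
    unfolding locale_comp_def locale_id_def compose_def using hk by (intro restrict_ext) simp
  moreover have "locale_comp M h k = locale_id M"
    unfolding locale_comp_def locale_id_def compose_def using kh by (intro restrict_ext) simp
  ultimately show "locale_iso L M h"
    using h unfolding locale_iso_def by blast
qed


section \<open>Scales from interpolation\<close>

text \<open>A new element only has to be compared with the greatest one found so far. Applied to a
  relation and to its converse, this selects the nearest earlier values below and above a new point
  of a scale.\<close>

lemma finite_chain_greatest:
  assumes "finite S" "S \<noteq> {}" "\<And>a b. a \<in> S \<Longrightarrow> b \<in> S \<Longrightarrow> a = b \<or> R a b \<or> R b a"
    and "\<And>a b c. R a b \<Longrightarrow> R b c \<Longrightarrow> R a c"
  shows "\<exists>m\<in>S. \<forall>a\<in>S. a = m \<or> R a m"
  using assms(1,2,3)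
proof (induction S rule: finite_ne_induct)
  case (insert x F)
  then obtain m where "m \<in> F" "\<forall>a\<in>F. a = m \<or> R a m" by auto
  moreover from \<open>m \<in> F\<close> have "x = m \<or> R x m \<or> R m x"
    using insert.prems by blast
  ultimately show ?case
    using assms(4)[of _ m x] by auto
qed simp

lemma rational_scale:
  fixes R :: "'a \<Rightarrow> 'a \<Rightarrow> bool"
  assumes trans: "\<And>a b c. R a b \<Longrightarrow> R b c \<Longrightarrow> R a c"
    and interp: "\<And>a b. R a b \<Longrightarrow> \<exists>c. R a c \<and> R c b"
    and xy: "R x y"
  shows "\<exists>s :: rat \<Rightarrow> 'a. s 0 = x \<and> s 1 = y \<and>
           (\<forall>p q. 0 \<le> p \<and> p < q \<and> q \<le> 1 \<longrightarrow> R (s p) (s q))"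
proof -
  \<comment> \<open>The values are chosen along an enumeration of the rationals: at each stage a new point is
    interpolated between its nearest predecessors on either side.\<close>
  define rank where "rank = (to_nat :: rat \<Rightarrow> nat)"
  \<comment> \<open>\<open>P f q r\<close> makes \<open>r\<close> an admissible value at
    \<open>q\<close>, given the values of \<open>f\<close> at points of smaller rank. Only points
    strictly between \<open>0\<close> and \<open>1\<close> are constrained.\<close>
  define P where "P f q r \<longleftrightarrow> 0 < q \<and> q < 1 \<longrightarrow> R x r \<and> R r y \<and>
      (\<forall>p. rank p < rank q \<and> 0 < p \<and> p < 1 \<longrightarrow> (p < q \<longrightarrow> R (f p) r) \<and> (q < p \<longrightarrow> R r (f p)))"
    for f q r
  \<comment> \<open>Dependent choice enters here, along the well-founded order by rank; it applies
    because \<open>P\<close> consults \<open>f\<close> only at smaller ranks.\<close>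
  have "\<exists>f. \<forall>q. P f q (f q)"
  proof (rule dependent_wf_choice[of "measure rank"])
    show "P f q r = P f' q r" if "\<And>p. (p, q) \<in> measure rank \<Longrightarrow> f p = f' p" for f f' q r
      using that by (auto simp: P_def)
    show "\<exists>r. P f q r" if hyp: "\<And>p. (p, q) \<in> measure rank \<Longrightarrow> P f p (f p)" for q f
    proof (cases "0 < q \<and> q < 1")
      case q: True
      have IH: "R x (f p)" "R (f p) y" if "rank p < rank q" "0 < p" "p < 1" for p
        using hyp[of p] that by (auto simp: P_def)
      \<comment> \<open>Of two earlier points, the one of larger rank was chosen with the other
        already in view, so its own condition relates the two values.\<close>
      have mono: "R (f p) (f p')"
        if "rank p < rank q" "rank p' < rank q" "0 < p" "p < p'" "p' < 1" for p p'
      proof -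
        have "rank p \<noteq> rank p'" using that by (auto simp: rank_def)
        then consider "rank p < rank p'" | "rank p' < rank p" by linarith
        then show ?thesis
        proof cases
          case 1
          then show ?thesis
            using hyp[of p'] that by (auto simp: P_def)
        next
          case 2
          then show ?thesis
            using hyp[of p] that by (auto simp: P_def)
        qed
      qed
      define Lo where "Lo = {p. rank p < rank q \<and> 0 < p \<and> p < q}"
      define Up where "Up = {p. rank p < rank q \<and> q < p \<and> p < 1}"
      have "finite {p. rank p < rank q}"
        unfolding rank_def using finite_vimageI[of "{..<to_nat q}" "to_nat :: rat \<Rightarrow> nat"]
        by (simp add: vimage_def)
      then have fin: "finite Lo" "finite Up"
        by (auto simp: Lo_def Up_def elim!: rev_finite_subset)
      \<comment> \<open>Including \<open>x\<close> supplies a left neighbour even when no earlier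
        point lies to the left of \<open>q\<close>; \<open>y\<close> plays the same part on the
        right.\<close>
      have "\<exists>l\<in>insert x (f ` Lo). \<forall>a\<in>insert x (f ` Lo). a = l \<or> R a l"
      proof (rule finite_chain_greatest)
        show "a = b \<or> R a b \<or> R b a" if ab: "a \<in> insert x (f ` Lo)" "b \<in> insert x (f ` Lo)" for a b
        proof (cases "a = x \<or> b = x")
          case True
          then show ?thesis using ab IH q by (auto simp: Lo_def)
        next
          case False
          then obtain p p' where "a = f p" "b = f p'" "p \<in> Lo" "p' \<in> Lo"
            using ab by blast
          then show ?thesis
            using mono[of p p'] mono[of p' p] q by (cases p p' rule: linorder_cases) (auto simp: Lo_def)
        qed
      qed (use fin in \<open>auto intro: trans\<close>)
      then obtain l where l: "l \<in> insert x (f ` Lo)" "\<forall>a\<in>insert x (f ` Lo). a = l \<or> R a l"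
        by blast
      have "\<exists>u\<in>insert y (f ` Up). \<forall>a\<in>insert y (f ` Up). a = u \<or> R u a"
      proof (rule finite_chain_greatest[of _ "\<lambda>a b. R b a"])
        show "a = b \<or> R b a \<or> R a b" if ab: "a \<in> insert y (f ` Up)" "b \<in> insert y (f ` Up)" for a b
        proof (cases "a = y \<or> b = y")
          case True
          then show ?thesis using ab IH q by (auto simp: Up_def)
        next
          case False
          then obtain p p' where "a = f p" "b = f p'" "p \<in> Up" "p' \<in> Up"
            using ab by blast
          then show ?thesis
            using mono[of p p'] mono[of p' p] q by (cases p p' rule: linorder_cases) (auto simp: Up_def)
        qed
      qed (use fin in \<open>auto intro: trans\<close>)
      then obtain u where u: "u \<in> insert y (f ` Up)" "\<forall>a\<in>insert y (f ` Up). a = u \<or> R u a"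
        by blast
      have "R l u"
        using l(1) u(1) IH mono xy q by (auto simp: Lo_def Up_def)
      then obtain r where r: "R l r" "R r u" using interp by blast
      have "R a r" if "a \<in> insert x (f ` Lo)" for a
        using l(2) that r(1) trans[OF _ r(1), of a] by auto
      moreover have "R r a" if "a \<in> insert y (f ` Up)" for a
        using u(2) that r(2) trans[OF r(2), of a] by auto
      ultimately have "P f q r"
        by (auto simp: P_def Lo_def Up_def)
      then show ?thesis ..
    qed (auto simp: P_def)
  qed simp
  then obtain f where f: "\<And>q. P f q (f q)" by blast
  \<comment> \<open>\<open>P\<close> says nothing about \<open>f\<close> at \<open>0\<close> and
    \<open>1\<close>, so the prescribed endpoints are put in here.\<close>
  define s where "s q = (if q = 0 then x else if q = 1 then y else f q)" for q
  have "R (s p) (s q)" if pq: "0 \<le> p" "p < q" "q \<le> 1" for p q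
  proof -
    have "rank p \<noteq> rank q" using pq by (auto simp: rank_def)
    then have "rank p < rank q \<or> rank q < rank p" by linarith
    then show ?thesis
      using f[of p] f[of q] pq xy by (auto simp: s_def P_def)
  qed
  then show ?thesis
    by (intro exI[of _ s]) (auto simp: s_def)
qed


section \<open>Closed ideals over a base\<close>

locale frame_base =
  fixes A :: "'a gorder" (structure) and B :: "'a set"
  assumes frame: "frame A" and base: "base A B"
begin

sublocale frame A by (rule frame)

abbreviation J :: "'a set gorder" where "J \<equiv> Id_Jm (sub A B)"

abbreviation below :: "'a \<Rightarrow> 'a set" where "below a \<equiv> {b \<in> B. b \<sqsubseteq> a}"

lemma sublattice: "sublattice A B"
  using base by (simp add: base_def)

lemma base_carrier: "b \<in> B \<Longrightarrow> b \<in> carrier A"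
  using sublattice by (auto simp: sublattice_def)

lemma base_bottom: "\<bottom> \<in> B" and base_top: "\<top> \<in> B"
  and base_join: "\<lbrakk>x \<in> B; y \<in> B\<rbrakk> \<Longrightarrow> x \<squnion> y \<in> B"
  and base_meet: "\<lbrakk>x \<in> B; y \<in> B\<rbrakk> \<Longrightarrow> x \<sqinter> y \<in> B"
  using sublattice by (auto simp: sublattice_def)

lemmas base_operations = sublattice_operations[OF frame sublattice]

lemma Jm_closure_iff:
  assumes "I \<subseteq> B"
  shows "x \<in> Jm_closure (sub A B) I \<longleftrightarrow>
    x \<in> B \<and> (\<forall>b\<in>B. x \<squnion> b = \<top> \<longrightarrow> (\<exists>y\<in>I. y \<squnion> b = \<top>))"
proof -
  have "y \<in> I \<Longrightarrow> b \<in> B \<Longrightarrow> y \<squnion>\<^bsub>sub A B\<^esub> b = y \<squnion> b" for y b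
    using assms base_operations(3) by auto
  then show ?thesis
    by (auto simp: Jm_closure_def base_operations cong: bex_cong ball_cong)
qed

text \<open>Every element of \<open>I\<close> witnesses its own membership in the closure, so
  \<open>cover\<close> supplies the one inclusion that needs an argument.\<close>

lemma closed_idealI:
  assumes IB: "I \<subseteq> B" and "\<bottom> \<in> I"
    and join: "\<And>x y. \<lbrakk>x \<in> I; y \<in> I\<rbrakk> \<Longrightarrow> x \<squnion> y \<in> I"
    and down: "\<And>x y. \<lbrakk>x \<in> I; y \<in> B; y \<sqsubseteq> x\<rbrakk> \<Longrightarrow> y \<in> I"
    and cover: "\<And>x. \<lbrakk>x \<in> B; \<And>b. \<lbrakk>b \<in> B; x \<squnion> b = \<top>\<rbrakk> \<Longrightarrow> \<exists>y\<in>I. y \<squnion> b = \<top>\<rbrakk> \<Longrightarrow> x \<in> I"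
  shows "I \<in> carrier J"
proof -
  have "x \<squnion>\<^bsub>sub A B\<^esub> y \<in> I" if "x \<in> I" "y \<in> I" for x y
    using join[OF that] that base_operations(3)[of x y] IB by (simp add: subset_iff)
  moreover have "\<forall>x\<in>I. \<forall>y\<in>B. y \<sqsubseteq> x \<longrightarrow> y \<in> I"
    using down by blast
  ultimately have "lattice_ideal (sub A B) I"
    unfolding lattice_ideal_def base_operations(1) using assms(1,2) by simp
  moreover have "Jm_closure (sub A B) I = I"
  proof
    show "Jm_closure (sub A B) I \<subseteq> I"
    proof
      fix x assume "x \<in> Jm_closure (sub A B) I"
      then show "x \<in> I"
        unfolding Jm_closure_iff[OF IB] by (intro cover) auto
    qed
    show "I \<subseteq> Jm_closure (sub A B) I"
      using IB by (auto simp: Jm_closure_iff[OF IB])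
  qed
  ultimately show ?thesis
    by (simp add: Id_Jm_def)
qed

context
  fixes I assumes I: "I \<in> carrier J"
begin

lemma closed_ideal_subset: "I \<subseteq> B"
  and closed_ideal_bottom: "\<bottom> \<in> I"
  and closed_ideal_down: "\<lbrakk>x \<in> I; y \<in> B; y \<sqsubseteq> x\<rbrakk> \<Longrightarrow> y \<in> I"
  using I by (auto simp: Id_Jm_def lattice_ideal_def base_operations(1))

lemma closed_ideal_join:
  assumes "x \<in> I" "y \<in> I"
  shows "x \<squnion> y \<in> I"
proof -
  have "x \<squnion>\<^bsub>sub A B\<^esub> y \<in> I"
    using I assms by (simp add: Id_Jm_def lattice_ideal_def)
  then show ?thesis
    using base_operations(3)[of x y] assms closed_ideal_subset by (simp add: subset_iff)
qed

lemma closed_ideal_cover: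
  assumes "x \<in> B" "\<And>b. \<lbrakk>b \<in> B; x \<squnion> b = \<top>\<rbrakk> \<Longrightarrow> \<exists>y\<in>I. y \<squnion> b = \<top>"
  shows "x \<in> I"
proof -
  have "x \<in> Jm_closure (sub A B) I"
    unfolding Jm_closure_iff[OF closed_ideal_subset] using assms by blast
  then show ?thesis
    using I by (simp add: Id_Jm_def)
qed

lemma below_subset_closed_ideal: "b \<in> I \<Longrightarrow> below b \<subseteq> I"
  using closed_ideal_down by blast

end

lemma le_J [simp]: "x \<sqsubseteq>\<^bsub>J\<^esub> y \<longleftrightarrow> x \<subseteq> y"
  by (simp add: Id_Jm_def)

section \<open>Conjunctivity, normality and complete regularity\<close>

lemma conjunctive_iff:
  "conjunctive_lattice (sub A B) \<longleftrightarrow>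
     (\<forall>a\<in>B. \<forall>b\<in>B. (\<forall>c\<in>B. a \<squnion> c = \<top> \<longrightarrow> b \<squnion> c = \<top>) \<longrightarrow> a \<sqsubseteq> b)"
  by (auto simp: conjunctive_lattice_def base_operations cong: ball_cong)

text \<open>When the upper element itself lies in \<open>B\<close>, it can serve as the
  \<open>d\<close> asked for in \<open>frame_conjunctive\<close>.\<close>

lemma conjunctive_if_frame_conjunctive:
  assumes "frame_conjunctive A B"
  shows "conjunctive_lattice (sub A B)"
  unfolding conjunctive_iff
proof (intro ballI impI)
  fix a b assume "a \<in> B" "b \<in> B" "\<forall>c\<in>B. a \<squnion> c = \<top> \<longrightarrow> b \<squnion> c = \<top>"
  then show "a \<sqsubseteq> b"
    using assms base_carrier le_refl unfolding frame_conjunctive_def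
    by (metis join_comm)
qed

lemma normal_iff:
  "normal_lattice (sub A B) \<longleftrightarrow>
     (\<forall>a\<in>B. \<forall>b\<in>B. a \<squnion> b = \<top> \<longrightarrow>
        (\<exists>c\<in>B. \<exists>d\<in>B. c \<squnion> a = \<top> \<and> b \<squnion> d = \<top> \<and> c \<sqinter> d = \<bottom>))"
  by (auto simp: normal_lattice_def base_operations cong: ball_cong bex_cong)

text \<open>The complement is required to lie in \<open>B\<close>, since normality only interpolates between
  elements of \<open>B\<close>.\<close>

definition well_inside_base :: "'a \<Rightarrow> 'a \<Rightarrow> bool" where
  "well_inside_base x y \<longleftrightarrow> x \<in> B \<and> y \<in> B \<and> (\<exists>z\<in>B. x \<sqinter> z = \<bottom> \<and> y \<squnion> z = \<top>)"

lemma well_inside_base_imp: "well_inside_base x y \<Longrightarrow> well_inside A x y"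
  unfolding well_inside_base_def well_inside_def using base_carrier by blast

text \<open>The complement that separates \<open>y\<close> from \<open>z\<close> also works for
  \<open>x\<close>, because \<open>x \<sqsubseteq> y\<close>.\<close>

lemma well_inside_base_trans:
  assumes "well_inside_base x y" "well_inside_base y z"
  shows "well_inside_base x z"
proof -
  obtain w where w: "w \<in> B" "y \<sqinter> w = \<bottom>" "z \<squnion> w = \<top>"
    using assms(2) unfolding well_inside_base_def by blast
  have "x \<sqsubseteq> y"
    using well_inside_le[OF frame] well_inside_base_imp[OF assms(1)] by simp
  then have "x \<sqinter> w = \<bottom>"
    using assms w base_carrier meet_bottom_mono[of x y w] by (auto simp: well_inside_base_def)
  then show ?thesis
    using assms w by (auto simp: well_inside_base_def)
qed

text \<open>Normality, applied to the cover of \<open>\<top>\<close> by \<open>w\<close> and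
  \<open>y\<close>, yields the interpolant \<open>c\<close>: \<open>x\<close> is inside
  \<open>c\<close> by means of \<open>w\<close>, and \<open>c\<close> is inside \<open>y\<close> by
  means of \<open>d\<close>.\<close>

lemma well_inside_base_interpolate:
  assumes "normal_lattice (sub A B)" "well_inside_base x y"
  shows "\<exists>z. well_inside_base x z \<and> well_inside_base z y"
proof -
  obtain w where w: "w \<in> B" "x \<sqinter> w = \<bottom>" "y \<squnion> w = \<top>" and xy: "x \<in> B" "y \<in> B"
    using assms(2) unfolding well_inside_base_def by blast
  obtain c d where "c \<in> B" "d \<in> B" "c \<squnion> w = \<top>" "y \<squnion> d = \<top>" "c \<sqinter> d = \<bottom>"
    using assms(1) w xy join_comm[of A] unfolding normal_iff by metis
  then show ?thesis
    using w xy unfolding well_inside_base_def by blast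
qed

lemma completely_regular_if_frame_conjunctive:
  assumes normal: "normal_lattice (sub A B)" and conj: "frame_conjunctive A B"
  shows "completely_regular_frame A"
  unfolding completely_regular_frame_def
proof (intro conjI frame ballI)
  fix a assume a: "a \<in> carrier A"
  let ?S = "{x. really_inside A x a}"
  have le: "x \<sqsubseteq> a" and closed: "x \<in> carrier A" if "x \<in> ?S" for x
    using that really_inside_le[OF frame, of x a] well_inside_le[OF frame, of x a]
    by (auto simp: well_inside_def)
  have S: "?S \<subseteq> carrier A" using closed by blast
  \<comment> \<open>As \<open>B\<close> is a base, \<open>a\<close> is a join of such
    \<open>b\<close>, so it suffices to bound each of them.\<close>
  have "b \<sqsubseteq> \<Squnion>?S" if b: "b \<in> B" "b \<sqsubseteq> a" for b
  proof -
    have "\<exists>d\<in>B. d \<sqsubseteq> \<Squnion>?S \<and> c \<squnion> d = \<top>" if c: "c \<in> B" "c \<squnion> b = \<top>" for c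
    proof -
      \<comment> \<open>Normality shrinks \<open>b\<close> to \<open>u\<close> without losing the
        cover with \<open>c\<close>; \<open>v\<close> is the complement showing \<open>u\<close>
        inside \<open>b\<close>. This \<open>u\<close> will be the \<open>d\<close> required by
        conjunctivity.\<close>
      obtain u v where uv: "u \<in> B" "v \<in> B" "u \<squnion> c = \<top>" "b \<squnion> v = \<top>" "u \<sqinter> v = \<bottom>"
        using normal b c unfolding normal_iff by blast
      then have "well_inside_base u b"
        using b by (auto simp: well_inside_base_def)
      have "\<exists>s :: rat \<Rightarrow> 'a. s 0 = u \<and> s 1 = b \<and>
          (\<forall>p q. 0 \<le> p \<and> p < q \<and> q \<le> 1 \<longrightarrow> well_inside_base (s p) (s q))"
        by (rule rational_scale[OF _ well_inside_base_interpolate[OF normal]])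
          (erule well_inside_base_trans, assumption+, fact)
      then obtain s :: "rat \<Rightarrow> 'a" where s: "s 0 = u" "s 1 = b"
        "\<forall>p q. 0 \<le> p \<and> p < q \<and> q \<le> 1 \<longrightarrow> well_inside_base (s p) (s q)"
        by auto
      then have "really_inside A u b"
        unfolding really_inside_def by (intro exI[of _ s]) (simp add: well_inside_base_imp)
      then have "u \<in> ?S"
        using really_inside_mono_right[OF frame] b(2) a by blast
      then show ?thesis
        using uv S sup_upper join_comm[of A u c] by metis
    qed
    then show ?thesis
      using conj sup_closed[OF S] b(1) unfolding frame_conjunctive_def by blast
  qed
  moreover obtain T where T: "T \<subseteq> B" "a = \<Squnion>T"
    using base a unfolding base_def by blast
  moreover have "T \<subseteq> carrier A"
    using T(1) base_carrier by blast
  ultimately have "a \<sqsubseteq> \<Squnion>?S"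
    using sup_upper[of T] sup_closed[OF S] by (auto intro!: sup_least)
  moreover have "\<Squnion>?S \<sqsubseteq> a"
    using le S a by (intro sup_least) auto
  ultimately show "a = \<Squnion>?S"
    using a sup_closed[OF S] by (rule le_antisym)
qed

end

section \<open>The comparison map\<close>

locale closed_ideal_comparison = frame_base A B + bA: frame bA
  for A :: "'a gorder" (structure) and B :: "'a set" and bA :: "'b gorder" +
  fixes eta :: "'b \<Rightarrow> 'a" and g :: "'a set \<Rightarrow> 'a" and h :: "'a set \<Rightarrow> 'b"
  assumes eta: "locale_map A bA eta"
    and g: "locale_map A (Id_Jm (sub A B)) g"
    and g_direct: "\<forall>a\<in>carrier A. direct_image A (Id_Jm (sub A B)) g a
           = Jm_closure (sub A B) {b \<in> B. b \<sqsubseteq> a}"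
    and h: "locale_map bA (Id_Jm (sub A B)) h"
    and g_eq: "g = locale_comp (Id_Jm (sub A B)) h eta"
    and conjunctive: "conjunctive_lattice (sub A B)"
begin

sublocale J: frame J
  using g by (simp add: locale_map_def)

abbreviation E :: "'a \<Rightarrow> 'b" where "E \<equiv> direct_image A bA eta"

section \<open>Direct images of elements of the base\<close>

lemma h_hom: "frame_hom J bA h"
  using h by (simp add: locale_map_def)

lemmas E_closed = direct_image_closed[OF eta]

text \<open>Conjunctivity says that principal ideals are already closed: if some
  \<open>y \<sqsubseteq> b\<close> covers \<open>\<top>\<close> together with \<open>c\<close>, then
  so does \<open>b\<close>.\<close>

lemma direct_image_below:
  assumes "b \<in> B"
  shows "direct_image A J g b = below b"
proof -
  have "x \<sqsubseteq> b" if x: "x \<in> B" and cl: "\<forall>c\<in>B. x \<squnion> c = \<top> \<longrightarrow> (\<exists>y\<in>below b. y \<squnion> c = \<top>)" for x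
  proof -
    have "b \<squnion> c = \<top>" if c: "c \<in> B" "x \<squnion> c = \<top>" for c
    proof -
      obtain y where "y \<in> B" "y \<sqsubseteq> b" "y \<squnion> c = \<top>" using cl c by blast
      then show ?thesis
        using join_top_mono[of y c b c] c assms base_carrier by auto
    qed
    then show ?thesis
      using conjunctive[unfolded conjunctive_iff, rule_format, OF x assms] by simp
  qed
  moreover have "direct_image A J g b = Jm_closure (sub A B) (below b)"
    using g_direct assms base_carrier by blast
  ultimately show ?thesis
    using Jm_closure_iff[of "below b"] by blast
qed

lemma below_closed: "b \<in> B \<Longrightarrow> below b \<in> carrier J"
  using direct_image_closed[OF g, of b] by (simp add: direct_image_below)

text \<open>In adjoint form, the direct image of \<open>h\<close> sends \<open>E b\<close> to
  \<open>below b\<close>. The proof chains the adjunction for \<open>eta\<close>, the factorization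
  of \<open>g\<close>, and the adjunction for \<open>g\<close>.\<close>

lemma h_le_E_iff:
  assumes "I \<in> carrier J" "b \<in> B"
  shows "h I \<sqsubseteq>\<^bsub>bA\<^esub> E b \<longleftrightarrow> I \<subseteq> below b"
proof -
  have "h I \<sqsubseteq>\<^bsub>bA\<^esub> E b \<longleftrightarrow> eta (h I) \<sqsubseteq> b"
    using direct_image_adjoint[OF eta frame_hom_closed[OF h_hom assms(1)] base_carrier[OF assms(2)]]
    by simp
  also have "eta (h I) = g I"
    using assms by (simp add: g_eq locale_comp_def compose_def)
  also have "g I \<sqsubseteq> b \<longleftrightarrow> I \<subseteq> below b"
    using direct_image_adjoint[OF g assms(1), of b] assms(2) base_carrier
    by (simp add: direct_image_below)
  finally show ?thesis .
qed

lemma h_below_le: "b \<in> B \<Longrightarrow> h (below b) \<sqsubseteq>\<^bsub>bA\<^esub> E b"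
  by (simp add: h_le_E_iff below_closed)

text \<open>The order is reflected because \<open>h (below b)\<close> lies below \<open>E b\<close>,
  hence below \<open>E c\<close>, which by \<open>h_le_E_iff\<close> means
  \<open>below b \<subseteq> below c\<close>.\<close>

lemma E_le_iff:
  assumes "b \<in> B" "c \<in> B"
  shows "E b \<sqsubseteq>\<^bsub>bA\<^esub> E c \<longleftrightarrow> b \<sqsubseteq> c"
proof
  assume "E b \<sqsubseteq>\<^bsub>bA\<^esub> E c"
  then have "h (below b) \<sqsubseteq>\<^bsub>bA\<^esub> E c"
    using bA.le_trans[OF h_below_le[OF assms(1)]] assms E_closed frame_hom_closed[OF h_hom]
    by (simp add: below_closed)
  then have "below b \<subseteq> below c"
    using assms by (simp add: h_le_E_iff below_closed)
  then show "b \<sqsubseteq> c"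
    using assms base_carrier by auto
next
  assume "b \<sqsubseteq> c"
  then show "E b \<sqsubseteq>\<^bsub>bA\<^esub> E c"
    using assms base_carrier by (intro direct_image_mono[OF eta])
qed

lemma E_inj: "inj_on E B"
proof (rule inj_onI)
  fix b c assume "b \<in> B" "c \<in> B" "E b = E c"
  then show "b = c"
    using E_le_iff[of b c] E_le_iff[of c b] E_closed base_carrier by (intro le_antisym) auto
qed

lemma E_top: "E \<top> = \<top>\<^bsub>bA\<^esub>"
proof -
  have "eta \<top>\<^bsub>bA\<^esub> \<sqsubseteq> \<top>"
    using eta frame_hom_closed by (fastforce simp: locale_map_def)
  then have "\<top>\<^bsub>bA\<^esub> \<sqsubseteq>\<^bsub>bA\<^esub> E \<top>"
    using direct_image_adjoint[OF eta, of "\<top>\<^bsub>bA\<^esub>" \<top>] by auto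
  then show ?thesis
    using bA.top_le_iff E_closed by blast
qed

section \<open>Principal ideals as a base of the frame of closed ideals\<close>

lemma below_top: "below \<top> = \<top>\<^bsub>J\<^esub>"
proof -
  have "\<top>\<^bsub>J\<^esub> \<subseteq> B"
    by (rule closed_ideal_subset) (rule J.top_closed)
  moreover have "B = below \<top>"
    using base_carrier by auto
  ultimately have "\<top>\<^bsub>J\<^esub> \<sqsubseteq>\<^bsub>J\<^esub> below \<top>" by simp
  then show ?thesis
    using J.top_le_iff[OF below_closed[OF base_top]] by simp
qed

lemma below_bottom: "below \<bottom> = \<bottom>\<^bsub>J\<^esub>"
proof (rule J.le_antisym)
  show "below \<bottom> \<sqsubseteq>\<^bsub>J\<^esub> \<bottom>\<^bsub>J\<^esub>"
    using below_subset_closed_ideal closed_ideal_bottom by simp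
qed (use below_closed[OF base_bottom] J.bottom_lower J.bottom_closed in simp_all)

text \<open>Any closed ideal that contains \<open>b\<close> and \<open>c\<close> contains
  \<open>b \<squnion> c\<close>, and with it the whole principal ideal; no description of joins in
  \<open>J\<close> is needed.\<close>

lemma below_join:
  assumes "b \<in> B" "c \<in> B"
  shows "below (b \<squnion> c) = below b \<squnion>\<^bsub>J\<^esub> below c"
proof (rule J.le_antisym)
  note cl = below_closed[OF assms(1)] below_closed[OF assms(2)]
    below_closed[OF base_join[OF assms]]
  show "below b \<squnion>\<^bsub>J\<^esub> below c \<sqsubseteq>\<^bsub>J\<^esub> below (b \<squnion> c)"
  proof (rule J.join_le)
    show "below b \<sqsubseteq>\<^bsub>J\<^esub> below (b \<squnion> c)" "below c \<sqsubseteq>\<^bsub>J\<^esub> below (b \<squnion> c)"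
      using E_le_iff assms base_carrier join_left[of b c] join_right[of b c]
      by (auto intro: le_trans)
  qed (use cl in auto)
  have "b \<in> below b \<squnion>\<^bsub>J\<^esub> below c" "c \<in> below b \<squnion>\<^bsub>J\<^esub> below c"
    using J.join_left[OF cl(1,2)] J.join_right[OF cl(1,2)] assms base_carrier by auto
  then show "below (b \<squnion> c) \<sqsubseteq>\<^bsub>J\<^esub> below b \<squnion>\<^bsub>J\<^esub> below c"
    using J.join_closed[OF cl(1,2)] by (simp add: below_subset_closed_ideal closed_ideal_join)
qed (use assms in \<open>simp_all add: below_closed base_join\<close>)

lemma below_meet:
  assumes "b \<in> B" "c \<in> B"
  shows "below (b \<sqinter> c) = below b \<sqinter>\<^bsub>J\<^esub> below c"
proof (rule J.le_antisym)
  note cl = below_closed[OF assms(1)] below_closed[OF assms(2)]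
    below_closed[OF base_meet[OF assms]]
  have "below b \<sqinter>\<^bsub>J\<^esub> below c \<subseteq> below b" "below b \<sqinter>\<^bsub>J\<^esub> below c \<subseteq> below c"
    using J.meet_left[OF cl(1,2)] J.meet_right[OF cl(1,2)] by auto
  then show "below b \<sqinter>\<^bsub>J\<^esub> below c \<sqsubseteq>\<^bsub>J\<^esub> below (b \<sqinter> c)"
    using assms base_carrier by (auto intro!: meet_le)
  show "below (b \<sqinter> c) \<sqsubseteq>\<^bsub>J\<^esub> below b \<sqinter>\<^bsub>J\<^esub> below c"
  proof (rule J.meet_le)
    show "below (b \<sqinter> c) \<sqsubseteq>\<^bsub>J\<^esub> below b" "below (b \<sqinter> c) \<sqsubseteq>\<^bsub>J\<^esub> below c"
      using assms base_carrier meet_left[of b c] meet_right[of b c]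
      by (auto intro: le_trans)
  qed (use cl in auto)
qed (use assms in \<open>simp_all add: below_closed base_meet\<close>)

text \<open>A closed ideal is already the union of the principal ideals inside it, so these generate
  \<open>J\<close> under joins.\<close>

lemma closed_ideal_eq_Sup:
  assumes "I \<in> carrier J"
  shows "I = \<Squnion>\<^bsub>J\<^esub>(below ` I)"
proof (rule J.le_antisym)
  have IB: "I \<subseteq> B" using assms by (rule closed_ideal_subset)
  then have S: "below ` I \<subseteq> carrier J" using below_closed by blast
  show "\<Squnion>\<^bsub>J\<^esub>(below ` I) \<sqsubseteq>\<^bsub>J\<^esub> I"
  proof (rule J.sup_least[OF S assms])
    show "K \<sqsubseteq>\<^bsub>J\<^esub> I" if "K \<in> below ` I" for K
      using that below_subset_closed_ideal[OF assms] by auto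
  qed
  show "I \<sqsubseteq>\<^bsub>J\<^esub> \<Squnion>\<^bsub>J\<^esub>(below ` I)"
    unfolding le_J
  proof
    fix b assume b: "b \<in> I"
    then have "below b \<subseteq> \<Squnion>\<^bsub>J\<^esub>(below ` I)"
      using J.sup_upper[OF S, of "below b"] by simp
    then show "b \<in> \<Squnion>\<^bsub>J\<^esub>(below ` I)"
      using b IB base_carrier le_refl by blast
  qed
  show "\<Squnion>\<^bsub>J\<^esub>(below ` I) \<in> carrier J" using S by (rule J.sup_closed)
qed (rule assms)

lemma image_base_if_bij:
  assumes bij: "bij_betw h (carrier J) (carrier bA)"
  shows "base bA (E ` B) \<and> frame_conjunctive bA (E ` B)"
proof -
  have onto: "\<exists>I\<in>carrier J. u = h I" if "u \<in> carrier bA" for u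
    using that bij by (auto simp: bij_betw_def)
  have h_eq: "I = K" if "I \<in> carrier J" "K \<in> carrier J" "h I = h K" for I K
    using that bij by (auto simp: bij_betw_def inj_on_def)
  have E_eq: "E b = h (below b)" if b: "b \<in> B" for b
  proof (rule bA.le_antisym)
    \<comment> \<open>Surjectivity turns \<open>E b\<close> itself into some \<open>h I\<close>, and
      \<open>h_le_E_iff\<close> then forces \<open>I \<subseteq> below b\<close>.\<close>
    obtain I where I: "I \<in> carrier J" "E b = h I" using onto E_closed by blast
    then have "I \<subseteq> below b"
      using h_le_E_iff[OF I(1) b] E_closed[of b] by simp
    then show "E b \<sqsubseteq>\<^bsub>bA\<^esub> h (below b)"
      using I frame_hom_mono[OF h_hom I(1) below_closed[OF b]] by simp
  qed (use b h_below_le E_closed frame_hom_closed[OF h_hom] below_closed in auto)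
  have EB: "E ` B \<subseteq> carrier bA" using E_closed by blast
  have E_join: "E b \<squnion>\<^bsub>bA\<^esub> E c = E (b \<squnion> c)" if "b \<in> B" "c \<in> B" for b c
    using that by (simp add: E_eq below_join frame_hom_join[OF h_hom] below_closed base_join)
  have E_meet: "E b \<sqinter>\<^bsub>bA\<^esub> E c = E (b \<sqinter> c)" if "b \<in> B" "c \<in> B" for b c
    using that by (simp add: E_eq below_meet frame_hom_meet[OF h_hom] below_closed base_meet)
  have E_bottom: "E \<bottom> = \<bottom>\<^bsub>bA\<^esub>"
    by (simp add: E_eq base_bottom below_bottom frame_hom_bottom[OF h_hom])
  have subl: "sublattice bA (E ` B)"
    unfolding sublattice_def
  proof (intro conjI ballI EB)
    show "\<bottom>\<^bsub>bA\<^esub> \<in> E ` B" "\<top>\<^bsub>bA\<^esub> \<in> E ` B"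
      using imageI[OF base_bottom, of E] imageI[OF base_top, of E] by (simp_all add: E_bottom E_top)
    fix u v assume "u \<in> E ` B" "v \<in> E ` B"
    then show "u \<squnion>\<^bsub>bA\<^esub> v \<in> E ` B" "u \<sqinter>\<^bsub>bA\<^esub> v \<in> E ` B"
      by (auto simp: E_join E_meet base_join base_meet)
  qed
  have "\<exists>S\<subseteq>E ` B. u = \<Squnion>\<^bsub>bA\<^esub>S" if u: "u \<in> carrier bA" for u
  proof -
    obtain I where I: "I \<in> carrier J" "u = h I" using onto u by blast
    then have IB: "I \<subseteq> B" using closed_ideal_subset by blast
    have "u = h (\<Squnion>\<^bsub>J\<^esub>(below ` I))"
      using I closed_ideal_eq_Sup by simp
    also have "\<dots> = \<Squnion>\<^bsub>bA\<^esub>(h ` below ` I)"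
      using IB below_closed by (intro frame_hom_Sup[OF h_hom]) blast
    also have "h ` below ` I = E ` I"
      unfolding image_image using IB E_eq by (intro image_cong) auto
    finally have "u = \<Squnion>\<^bsub>bA\<^esub>(E ` I)" .
    then show ?thesis using image_mono[OF IB] by (intro exI[of _ "E ` I"] conjI)
  qed
  then have "base bA (E ` B)"
    using subl by (simp add: base_def)
  moreover have "E b \<sqsubseteq>\<^bsub>bA\<^esub> u"
    if u: "u \<in> carrier bA" and b: "b \<in> B"
      and cover: "\<And>c. \<lbrakk>c \<in> B; E c \<squnion>\<^bsub>bA\<^esub> E b = \<top>\<^bsub>bA\<^esub>\<rbrakk> \<Longrightarrow>
        \<exists>d\<in>B. E d \<sqsubseteq>\<^bsub>bA\<^esub> u \<and> E c \<squnion>\<^bsub>bA\<^esub> E d = \<top>\<^bsub>bA\<^esub>" for u b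
  proof -
    obtain I where I: "I \<in> carrier J" "u = h I" using onto u by blast
    \<comment> \<open>The hypothesis of conjunctivity, pulled back to \<open>B\<close>, becomes the
      covering condition that puts \<open>b\<close> into the closed ideal \<open>I\<close>.\<close>
    have "\<exists>y\<in>I. y \<squnion> c = \<top>" if c: "c \<in> B" "b \<squnion> c = \<top>" for c
    proof -
      have "E c \<squnion>\<^bsub>bA\<^esub> E b = \<top>\<^bsub>bA\<^esub>"
        using E_join b c E_top join_comm[of A b c] by simp
      then obtain d where d: "d \<in> B" "E d \<sqsubseteq>\<^bsub>bA\<^esub> u" "E c \<squnion>\<^bsub>bA\<^esub> E d = \<top>\<^bsub>bA\<^esub>"
        using cover c by blast
      have "E (c \<squnion> d) = E \<top>"
        using E_join c d E_top by simp
      then have "c \<squnion> d = \<top>"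
        using E_inj base_join base_top c d by (meson inj_onD)
      \<comment> \<open>\<open>h\<close> preserves meets and is injective, so it reflects the order;
        the inclusion is therefore phrased as an equation between meets.\<close>
      moreover have "below d \<sqinter>\<^bsub>J\<^esub> I = below d"
      proof (rule h_eq)
        have "h (below d) \<sqsubseteq>\<^bsub>bA\<^esub> h I" using d I E_eq by simp
        then show "h (below d \<sqinter>\<^bsub>J\<^esub> I) = h (below d)"
          using d(1) I(1) bA.le_iff_join[of "h (below d)" "h I"] frame_hom_closed[OF h_hom]
          by (simp add: frame_hom_meet[OF h_hom] below_closed)
      qed (use d I below_closed in auto)
      then have "below d \<subseteq> I"
        using J.meet_right[OF below_closed[OF d(1)] I(1)] by simp
      ultimately show ?thesis
        using d(1) base_carrier join_comm[of A c d] by auto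
    qed
    then have "b \<in> I"
      by (rule closed_ideal_cover[OF I(1) b])
    then have "below b \<subseteq> I"
      by (rule below_subset_closed_ideal[OF I(1)])
    then show ?thesis
      using E_eq[OF b] I frame_hom_mono[OF h_hom below_closed[OF b] I(1)] by simp
  qed
  then have "frame_conjunctive bA (E ` B)"
    unfolding frame_conjunctive_def using subl by auto
  ultimately show ?thesis ..
qed

lemma bij_if_image_base:
  assumes cr: "compact_regular bA" and bs: "base bA (E ` B)" and fc: "frame_conjunctive bA (E ` B)"
  shows "bij_betw h (carrier J) (carrier bA)"
proof -
  have subl: "sublattice bA (E ` B)" using bs by (simp add: base_def)
  \<comment> \<open>The join of \<open>E b\<close> and \<open>E c\<close> is some \<open>E d\<close>
    because the image is a sublattice; as \<open>E\<close> reflects the order, \<open>d\<close> is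
    an upper bound of \<open>b\<close> and \<open>c\<close>.\<close>
  have E_join: "E (b \<squnion> c) = E b \<squnion>\<^bsub>bA\<^esub> E c" if bc: "b \<in> B" "c \<in> B" for b c
  proof (rule bA.le_antisym)
    obtain d where d: "d \<in> B" "E b \<squnion>\<^bsub>bA\<^esub> E c = E d"
      using subl bc unfolding sublattice_def by blast
    have "E b \<sqsubseteq>\<^bsub>bA\<^esub> E d" "E c \<sqsubseteq>\<^bsub>bA\<^esub> E d"
      unfolding d(2)[symmetric] by (simp_all add: bA.join_left bA.join_right E_closed)
    then have "b \<squnion> c \<sqsubseteq> d"
      using bc d E_le_iff base_carrier by (intro join_le) auto
    then show "E (b \<squnion> c) \<sqsubseteq>\<^bsub>bA\<^esub> E b \<squnion>\<^bsub>bA\<^esub> E c"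
      using bc d E_le_iff base_join by simp
    show "E b \<squnion>\<^bsub>bA\<^esub> E c \<sqsubseteq>\<^bsub>bA\<^esub> E (b \<squnion> c)"
      using bc E_le_iff base_join base_carrier join_left join_right E_closed
      by (intro bA.join_le) auto
  qed (use E_closed in auto)
  have E_bottom: "E \<bottom> = \<bottom>\<^bsub>bA\<^esub>"
  proof -
    obtain d where d: "d \<in> B" "\<bottom>\<^bsub>bA\<^esub> = E d"
      using subl unfolding sublattice_def by blast
    then have "E \<bottom> \<sqsubseteq>\<^bsub>bA\<^esub> \<bottom>\<^bsub>bA\<^esub>"
      using E_le_iff[of \<bottom> d] base_bottom base_carrier by simp
    then show ?thesis
      using E_closed by (intro bA.le_antisym) auto
  qed
  have E_join_top: "E b \<squnion>\<^bsub>bA\<^esub> E c = \<top>\<^bsub>bA\<^esub> \<longleftrightarrow> b \<squnion> c = \<top>" if "b \<in> B" "c \<in> B" for b c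
    using that E_join E_top E_inj base_join base_top by (metis inj_onD)
  \<comment> \<open>The candidate inverse of \<open>h\<close>: the part of the base below
    \<open>u\<close>, pulled back to \<open>B\<close> along \<open>E\<close>.\<close>
  define psi where "psi u = {b \<in> B. E b \<sqsubseteq>\<^bsub>bA\<^esub> u}" for u
  have E_psi: "E ` psi u \<subseteq> carrier bA" for u using E_closed by auto
  have psi_closed: "psi u \<in> carrier J" if u: "u \<in> carrier bA" for u
  proof (rule closed_idealI)
    show "psi u \<subseteq> B" by (auto simp: psi_def)
    show "\<bottom> \<in> psi u" using E_bottom u base_bottom by (simp add: psi_def)
    show "x \<squnion> y \<in> psi u" if "x \<in> psi u" "y \<in> psi u" for x y
      using that u E_join E_closed base_join by (auto simp: psi_def intro: bA.join_le)
    show "y \<in> psi u" if "x \<in> psi u" "y \<in> B" "y \<sqsubseteq> x" for x y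
      using that u E_le_iff[of y x] E_closed bA.le_trans[of "E y" "E x" u] by (auto simp: psi_def)
    show "x \<in> psi u" if x: "x \<in> B"
      and cl: "\<And>b. \<lbrakk>b \<in> B; x \<squnion> b = \<top>\<rbrakk> \<Longrightarrow> \<exists>y\<in>psi u. y \<squnion> b = \<top>" for x
    proof -
      \<comment> \<open>\<open>E_join_top\<close> moves covers of the top between \<open>B\<close>
        and its image, so the closure condition on \<open>x\<close> becomes the conjunctivity
        condition on \<open>E x\<close>.\<close>
      have "\<exists>d\<in>E ` B. d \<sqsubseteq>\<^bsub>bA\<^esub> u \<and> c \<squnion>\<^bsub>bA\<^esub> d = \<top>\<^bsub>bA\<^esub>"
        if c: "c \<in> E ` B" "c \<squnion>\<^bsub>bA\<^esub> E x = \<top>\<^bsub>bA\<^esub>" for c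
      proof -
        obtain b where b: "b \<in> B" "c = E b" using c by blast
        then have "x \<squnion> b = \<top>"
          using c(2) E_join_top x join_comm[of A x b] by simp
        then obtain y where "y \<in> psi u" "y \<squnion> b = \<top>" using cl b by blast
        then show ?thesis
          using b E_join_top[of b y] join_comm[of A y b] by (auto simp: psi_def)
      qed
      then have "E x \<sqsubseteq>\<^bsub>bA\<^esub> u"
        using fc u x unfolding frame_conjunctive_def by blast
      then show ?thesis using x by (simp add: psi_def)
    qed
  qed
  have psi_Sup: "\<Squnion>\<^bsub>bA\<^esub>(E ` psi u) = u" if u: "u \<in> carrier bA" for u
  proof (rule bA.le_antisym)
    show "\<Squnion>\<^bsub>bA\<^esub>(E ` psi u) \<sqsubseteq>\<^bsub>bA\<^esub> u"
      using E_psi u by (intro bA.sup_least) (auto simp: psi_def)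
    obtain S where S: "S \<subseteq> E ` B" "u = \<Squnion>\<^bsub>bA\<^esub>S" using bs u unfolding base_def by blast
    then have Sc: "S \<subseteq> carrier bA" using E_closed by blast
    have "S \<subseteq> E ` psi u"
      using S bA.sup_upper[OF Sc] by (auto simp: psi_def)
    then have "\<Squnion>\<^bsub>bA\<^esub>S \<sqsubseteq>\<^bsub>bA\<^esub> \<Squnion>\<^bsub>bA\<^esub>(E ` psi u)"
      using E_psi by (rule bA.Sup_mono)
    then show "u \<sqsubseteq>\<^bsub>bA\<^esub> \<Squnion>\<^bsub>bA\<^esub>(E ` psi u)" using S by simp
  qed (use E_psi u in auto)
  \<comment> \<open>Directedness of ideals, which will replace a finite subcover by a single
    element.\<close>
  have ideal_finite: "\<exists>y\<in>I. \<forall>x\<in>F. x \<sqsubseteq> y"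
    if I: "I \<in> carrier J" and F: "finite F" "F \<subseteq> I" for I F
    using F
  proof (induction F rule: finite_induct)
    case empty
    then show ?case using closed_ideal_bottom[OF I] by blast
  next
    case (insert x F)
    then obtain y where y: "y \<in> I" "\<forall>x\<in>F. x \<sqsubseteq> y" by auto
    have "insert x (insert y F) \<subseteq> carrier A"
      using closed_ideal_subset[OF I] insert.prems y(1) base_carrier by blast
    then have "\<forall>z\<in>insert x F. z \<sqsubseteq> x \<squnion> y"
      using y(2) join_left[of x y] join_right[of x y] by (auto intro: le_trans)
    moreover have "x \<squnion> y \<in> I"
      using closed_ideal_join[OF I] insert.prems y(1) by blast
    ultimately show ?case by blast
  qed
  have Sup_psi: "psi (\<Squnion>\<^bsub>bA\<^esub>(E ` I)) = I" if I: "I \<in> carrier J" for I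
  proof
    have IB: "I \<subseteq> B" using I by (rule closed_ideal_subset)
    have EI: "E ` I \<subseteq> carrier bA" using E_closed by blast
    show "I \<subseteq> psi (\<Squnion>\<^bsub>bA\<^esub>(E ` I))"
      using IB bA.sup_upper[OF EI] by (auto simp: psi_def)
    show "psi (\<Squnion>\<^bsub>bA\<^esub>(E ` I)) \<subseteq> I"
    proof
      fix b assume "b \<in> psi (\<Squnion>\<^bsub>bA\<^esub>(E ` I))"
      then have b: "b \<in> B" "E b \<sqsubseteq>\<^bsub>bA\<^esub> \<Squnion>\<^bsub>bA\<^esub>(E ` I)" by (auto simp: psi_def)
      have "\<exists>y\<in>I. y \<squnion> c = \<top>" if c: "c \<in> B" "b \<squnion> c = \<top>" for c
      proof -
        let ?S = "insert (E c) (E ` I)"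
        have S: "?S \<subseteq> carrier bA" using E_closed by blast
        have "\<Squnion>\<^bsub>bA\<^esub>(E ` I) \<sqsubseteq>\<^bsub>bA\<^esub> \<Squnion>\<^bsub>bA\<^esub>?S"
          using S by (intro bA.Sup_mono) auto
        then have "E b \<sqsubseteq>\<^bsub>bA\<^esub> \<Squnion>\<^bsub>bA\<^esub>?S"
          using bA.le_trans[OF b(2)] E_closed EI S by simp
        moreover have "E c \<sqsubseteq>\<^bsub>bA\<^esub> \<Squnion>\<^bsub>bA\<^esub>?S"
          using S by (intro bA.sup_upper) auto
        ultimately have "E b \<squnion>\<^bsub>bA\<^esub> E c \<sqsubseteq>\<^bsub>bA\<^esub> \<Squnion>\<^bsub>bA\<^esub>?S"
          using S E_closed by (intro bA.join_le) auto
        then have "\<Squnion>\<^bsub>bA\<^esub>?S = \<top>\<^bsub>bA\<^esub>"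
          using E_join_top[OF b(1) c(1)] c(2) bA.top_le_iff[OF bA.sup_closed[OF S]] by simp
        then obtain F where F: "F \<subseteq> ?S" "finite F" "\<Squnion>\<^bsub>bA\<^esub>F = \<top>\<^bsub>bA\<^esub>"
          using cr S unfolding compact_regular_def compact_frame_def by blast
        \<comment> \<open>Setting \<open>E c\<close> aside leaves only members that come from
          \<open>I\<close>, which have a common bound \<open>y\<close> there.\<close>
        have "finite (F - {E c})" "F - {E c} \<subseteq> E ` I" using F by auto
        then obtain F' where F': "F' \<subseteq> I" "finite F'" "F - {E c} = E ` F'"
          by (metis finite_subset_image)
        obtain y where y: "y \<in> I" "\<forall>x\<in>F'. x \<sqsubseteq> y"
          using ideal_finite[OF I F'(2,1)] by blast
        have yB: "y \<in> B" using y IB by blast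
        have "x \<sqsubseteq>\<^bsub>bA\<^esub> E y \<squnion>\<^bsub>bA\<^esub> E c" if "x \<in> F" for x
        proof (cases "x = E c")
          case True
          then show ?thesis using bA.join_right[of "E y" "E c"] E_closed by simp
        next
          case False
          then obtain z where z: "z \<in> F'" "x = E z" using F'(3) \<open>x \<in> F\<close> by blast
          then have "E z \<sqsubseteq>\<^bsub>bA\<^esub> E y" using y F' IB yB E_le_iff[of z y] by blast
          then show ?thesis
            using z(2) bA.le_trans[OF _ bA.join_left[OF E_closed E_closed]] E_closed by auto
        qed
        then have "\<Squnion>\<^bsub>bA\<^esub>F \<sqsubseteq>\<^bsub>bA\<^esub> E y \<squnion>\<^bsub>bA\<^esub> E c"
          using F(1) S E_closed by (intro bA.sup_least) auto
        then have "E y \<squnion>\<^bsub>bA\<^esub> E c = \<top>\<^bsub>bA\<^esub>"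
          using F(3) bA.top_le_iff E_closed by simp
        then show ?thesis
          using E_join_top yB c y(1) by blast
      qed
      then show "b \<in> I"
        by (rule closed_ideal_cover[OF I b(1)])
    qed
  qed
  have h_psi_le: "h (psi u) \<sqsubseteq>\<^bsub>bA\<^esub> u" if u: "u \<in> carrier bA" for u
  proof -
    \<comment> \<open>\<open>psi u\<close> is the join of principal ideals, and \<open>h\<close>
      sends each of them below some \<open>E b\<close> that is below \<open>u\<close>.\<close>
    have S: "below ` psi u \<subseteq> carrier J"
      using below_closed by (auto simp: psi_def)
    have "\<Squnion>\<^bsub>bA\<^esub>(h ` below ` psi u) \<sqsubseteq>\<^bsub>bA\<^esub> u"
    proof (rule bA.sup_least)
      show "h ` below ` psi u \<subseteq> carrier bA" using S frame_hom_closed[OF h_hom] by blast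
      fix v assume "v \<in> h ` below ` psi u"
      then obtain b where b: "b \<in> B" "E b \<sqsubseteq>\<^bsub>bA\<^esub> u" "v = h (below b)"
        by (auto simp: psi_def)
      then show "v \<sqsubseteq>\<^bsub>bA\<^esub> u"
        using bA.le_trans[OF h_below_le[OF b(1)] b(2)] u E_closed below_closed
          frame_hom_closed[OF h_hom] by simp
    qed (rule u)
    then show ?thesis
      using closed_ideal_eq_Sup[OF psi_closed[OF u]] frame_hom_Sup[OF h_hom S] by simp
  qed
  have h_psi: "h (psi u) = u" if u: "u \<in> carrier bA" for u
  proof (rule bA.le_antisym)
    have hc: "h (psi v) \<in> carrier bA" if "v \<in> carrier bA" for v
      using that psi_closed frame_hom_closed[OF h_hom] by blast
    \<comment> \<open>By regularity it suffices to treat \<open>x\<close> well inside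
      \<open>u\<close>. The complement \<open>z\<close> is carried through \<open>psi\<close> and
      \<open>h\<close> as well, and \<open>h (psi z)\<close> below \<open>z\<close> brings the cover
      back to \<open>z\<close> itself.\<close>
    have "x \<sqsubseteq>\<^bsub>bA\<^esub> h (psi u)" if inside: "well_inside bA x u" for x
    proof -
      obtain z where z: "z \<in> carrier bA" "x \<sqinter>\<^bsub>bA\<^esub> z = \<bottom>\<^bsub>bA\<^esub>" "u \<squnion>\<^bsub>bA\<^esub> z = \<top>\<^bsub>bA\<^esub>"
        and x: "x \<in> carrier bA"
        using inside unfolding well_inside_def by blast
      define I where "I = psi u \<squnion>\<^bsub>J\<^esub> psi z"
      have I: "I \<in> carrier J" using psi_closed u z by (simp add: I_def)
      have EI: "E ` I \<subseteq> carrier bA" using E_closed by blast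
      have upper: "v \<sqsubseteq>\<^bsub>bA\<^esub> \<Squnion>\<^bsub>bA\<^esub>(E ` I)" if v: "v \<in> carrier bA" "psi v \<subseteq> I" for v
      proof -
        have "\<Squnion>\<^bsub>bA\<^esub>(E ` psi v) \<sqsubseteq>\<^bsub>bA\<^esub> \<Squnion>\<^bsub>bA\<^esub>(E ` I)"
          using EI v(2) by (intro bA.Sup_mono image_mono)
        then show ?thesis using psi_Sup[OF v(1)] by simp
      qed
      have "psi u \<subseteq> I" "psi z \<subseteq> I"
        using J.join_left J.join_right psi_closed u z by (auto simp: I_def simp flip: le_J)
      then have "u \<squnion>\<^bsub>bA\<^esub> z \<sqsubseteq>\<^bsub>bA\<^esub> \<Squnion>\<^bsub>bA\<^esub>(E ` I)"
        using u z EI upper by (intro bA.join_le) auto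
      then have "\<Squnion>\<^bsub>bA\<^esub>(E ` I) = \<top>\<^bsub>bA\<^esub>"
        using z(3) bA.top_le_iff EI by simp
      \<comment> \<open>\<open>psi\<close> recovers \<open>I\<close> from its join, so
        \<open>I\<close> is all of \<open>B\<close>, the top of \<open>J\<close>: thus
        \<open>psi u\<close> and \<open>psi z\<close> cover \<open>J\<close>, although
        \<open>psi\<close> has not been shown to preserve joins.\<close>
      then have "I = psi \<top>\<^bsub>bA\<^esub>" using Sup_psi[OF I] by simp
      also have "\<dots> = B" using E_closed by (auto simp: psi_def)
      also have "\<dots> = \<top>\<^bsub>J\<^esub>" using below_top base_carrier by auto
      finally have "h (psi u) \<squnion>\<^bsub>bA\<^esub> h (psi z) = \<top>\<^bsub>bA\<^esub>"
        using frame_hom_join[OF h_hom psi_closed[OF u] psi_closed[OF z(1)]] frame_hom_top[OF h_hom]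
        by (simp add: I_def)
      then have "h (psi u) \<squnion>\<^bsub>bA\<^esub> z = \<top>\<^bsub>bA\<^esub>"
        using bA.join_top_mono[of "h (psi u)" "h (psi z)" "h (psi u)" z] h_psi_le hc u z by simp
      then show ?thesis
        using bA.le_if_meet_bottom_join_top[OF x hc[OF u] z(1,2)] by simp
    qed
    then have "\<Squnion>\<^bsub>bA\<^esub>{x. well_inside bA x u} \<sqsubseteq>\<^bsub>bA\<^esub> h (psi u)"
      using hc u by (intro bA.sup_least) (auto simp: well_inside_def)
    then show "u \<sqsubseteq>\<^bsub>bA\<^esub> h (psi u)"
      using cr u unfolding compact_regular_def regular_frame_def by simp
  qed (use u h_psi_le psi_closed frame_hom_closed[OF h_hom] in auto)
  have "psi (h I) = I" if I: "I \<in> carrier J" for I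
  proof -
    \<comment> \<open>Writing \<open>I\<close> as \<open>psi\<close> of this join and applying
      \<open>h_psi\<close> identifies \<open>h I\<close> with the join.\<close>
    have "\<Squnion>\<^bsub>bA\<^esub>(E ` I) \<in> carrier bA" using E_closed by (intro bA.sup_closed) blast
    from h_psi[OF this] have "h I = \<Squnion>\<^bsub>bA\<^esub>(E ` I)" using Sup_psi[OF I] by simp
    then show ?thesis using Sup_psi[OF I] by simp
  qed
  then show ?thesis
    using h_psi psi_closed frame_hom_closed[OF h_hom] by (intro bij_betwI[of h _ _ psi]) auto
qed

lemma locale_iso_iff_image_base:
  assumes "compact_regular bA"
  shows "locale_iso bA J h \<longleftrightarrow> base bA (E ` B) \<and> frame_conjunctive bA (E ` B)"
  using locale_iso_iff_bij[OF h] image_base_if_bij bij_if_image_base[OF assms] by blast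

end

theorem theorem2p13:
  fixes A :: "'a gorder" and bA :: "'b gorder" and eta :: "'b \<Rightarrow> 'a"
    and B :: "'a set" and g :: "'a set \<Rightarrow> 'a" and h :: "'a set \<Rightarrow> 'b"
  assumes "frame A"
    and "stone_cech A bA eta"
    and "base A B"
    and "normal_lattice (sub A B)"
    and "locale_map A (Id_Jm (sub A B)) g"
    and "\<forall>a\<in>carrier A. direct_image A (Id_Jm (sub A B)) g a
           = Jm_closure (sub A B) {b \<in> B. b \<sqsubseteq>\<^bsub>A\<^esub> a}"
    and "locale_map bA (Id_Jm (sub A B)) h"
    and "g = locale_comp (Id_Jm (sub A B)) h eta"
  shows
    "(conjunctive_lattice (sub A B) \<longrightarrow>
        (locale_iso bA (Id_Jm (sub A B)) h \<longleftrightarrow>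
           inj_on (direct_image A bA eta) B \<and>
           base bA (direct_image A bA eta ` B) \<and>
           frame_conjunctive bA (direct_image A bA eta ` B))) \<and>
     (completely_regular_frame A \<and> conjunctive_lattice (sub A B) \<longrightarrow>
        (locale_iso bA (Id_Jm (sub A B)) h \<longleftrightarrow>
           base bA (direct_image A bA eta ` B) \<and>
           frame_conjunctive bA (direct_image A bA eta ` B))) \<and>
     (frame_conjunctive A B \<longrightarrow>
        completely_regular_frame A \<and> conjunctive_lattice (sub A B))"
proof -
  interpret frame_base A B
    using assms by (simp add: frame_base_def)
  have cr: "compact_regular bA" and eta: "locale_map A bA eta"
    using assms(2) by (auto simp: stone_cech_def)
  \<comment> \<open>Injectivity is obtained alongside the equivalence, so both equivalences in the
    statement follow from this one fact.\<close>
  have main: "inj_on (direct_image A bA eta) B \<and>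
      (locale_iso bA (Id_Jm (sub A B)) h \<longleftrightarrow>
         base bA (direct_image A bA eta ` B) \<and>
         frame_conjunctive bA (direct_image A bA eta ` B))"
    if "conjunctive_lattice (sub A B)"
  proof -
    interpret closed_ideal_comparison A B bA eta g h
      using assms that eta frame_base_axioms
      by (simp add: closed_ideal_comparison_def closed_ideal_comparison_axioms_def locale_map_def)
    show ?thesis
      using E_inj locale_iso_iff_image_base[OF cr] by blast
  qed
  show ?thesis
    using main conjunctive_if_frame_conjunctive completely_regular_if_frame_conjunctive[OF assms(4)]
    by blast
qed

end
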